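(* Let $L,U\in\mathbb{R}^\eta$, $[L,U]=\{x\in\mathbb{R}^\eta:L_i\le x_i\le U_i\ \forall i\}$, $w\in\mathbb{R}^\eta$, $b\in\mathbb{R}$, and consider the family of inequalities $$y\le\sum_{i\in I}w_i(x_i-\breve L_i(1-z))+\left(b+\sum_{i\notin I}w_i\breve U_i\right)z,\qquad I\subseteq\{1,\dots,\eta\}.$$ Take $(\hat x,\hat y,\hat z)\in[L,U]\times\mathbb{R}_{\ge0}\times[0,1]$, along with the set $$\hat I=\left\{i\in\{1,\dots,\eta\}: w_i\hat x_i<w_i\left(\breve L_i(1-\hat z)+\breve U_i\hat z\right)\right\}.$$ If $$\hat y>b\hat z+\sum_{i\in\hat I}w_i\left(\hat x_i-\breve L_i(1-\hat z)\right)+\sum_{i\notin\hat I}w_i\breve U_i\hat z,$$ then the constraint of the family corresponding to $\hat I$ is the most violated in the family. Otherwise, no inequality in the family is violated at $(\hat x,\hat y,\hat z)$.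
   Context: For each $i$: $\breve L_i=L_i$ and $\breve U_i=U_i$ if $w_i\ge0$; $\breve L_i=U_i$ and $\breve U_i=L_i$ if $w_i<0$. *)

theory Defs
  imports "HOL-Analysis.Analysis"
begin

definition L_breve :: "real^'n \<Rightarrow> real^'n \<Rightarrow> real^'n \<Rightarrow> real^'n" where
  "L_breve w L U = (\<chi> i. if w $ i \<ge> 0 then L $ i else U $ i)"

definition U_breve :: "real^'n \<Rightarrow> real^'n \<Rightarrow> real^'n \<Rightarrow> real^'n" where
  "U_breve w L U = (\<chi> i. if w $ i \<ge> 0 then U $ i else L $ i)"

text \<open>The family of inequalities consists of \<open>y \<le> ineq_rhs w b L U I x z\<close>, one for each set \<open>I\<close>
  of coordinates.\<close>

definition ineq_rhs ::
    "real^'n \<Rightarrow> real \<Rightarrow> real^'n \<Rightarrow> real^'n \<Rightarrow> 'n set \<Rightarrow> real^'n \<Rightarrow> real \<Rightarrow> real" where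
  "ineq_rhs w b L U I x z =
     (\<Sum>i\<in>I. w $ i * (x $ i - L_breve w L U $ i * (1 - z)))
     + (b + (\<Sum>i\<in>-I. w $ i * U_breve w L U $ i)) * z"

definition violated ::
    "real^'n \<Rightarrow> real \<Rightarrow> real^'n \<Rightarrow> real^'n \<Rightarrow> 'n set \<Rightarrow> real^'n \<Rightarrow> real \<Rightarrow> real \<Rightarrow> bool" where
  "violated w b L U I x y z \<longleftrightarrow> \<not> y \<le> ineq_rhs w b L U I x z"

definition violation ::
    "real^'n \<Rightarrow> real \<Rightarrow> real^'n \<Rightarrow> real^'n \<Rightarrow> 'n set \<Rightarrow> real^'n \<Rightarrow> real \<Rightarrow> real \<Rightarrow> real" where
  "violation w b L U I x y z = y - ineq_rhs w b L U I x z"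

text \<open>A most violated inequality is violated, and by the largest amount in the family. It need not
  be unique: if \<open>w $ i = 0\<close>, adding \<open>i\<close> to \<open>I\<close> does not change the inequality.\<close>

definition most_violated ::
    "real^'n \<Rightarrow> real \<Rightarrow> real^'n \<Rightarrow> real^'n \<Rightarrow> 'n set \<Rightarrow> real^'n \<Rightarrow> real \<Rightarrow> real \<Rightarrow> bool" where
  "most_violated w b L U I x y z \<longleftrightarrow>
     violated w b L U I x y z \<and>
     (\<forall>J. violation w b L U J x y z \<le> violation w b L U I x y z)"

definition I_hat ::
    "real^'n \<Rightarrow> real^'n \<Rightarrow> real^'n \<Rightarrow> real^'n \<Rightarrow> real \<Rightarrow> 'n set" where
  "I_hat w L U x z =
     {i. w $ i * x $ i < w $ i * (L_breve w L U $ i * (1 - z) + U_breve w L U $ i * z)}"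

end

theory Submission imports Defs begin

text \<open>The right-hand side separates over the coordinates: each \<open>i\<close> contributes one of two terms,
  according to whether \<open>i \<in> I\<close>, and \<open>I_hat\<close> selects the smaller one in every coordinate. Hence
  it minimises the right-hand side over all \<open>I\<close>.\<close>

text \<open>With \<open>z\<close> multiplied into the second sum, the right-hand side matches the
  threshold in the theorem.\<close>

lemma ineq_rhs_expand:
  "ineq_rhs w b L U I x z =
     b * z + (\<Sum>i\<in>I. w $ i * (x $ i - L_breve w L U $ i * (1 - z)))
           + (\<Sum>i\<in>-I. w $ i * U_breve w L U $ i * z)"
  by (simp add: ineq_rhs_def distrib_right sum_distrib_right)

lemma ineq_rhs_eq_sum:
  "ineq_rhs w b L U I x z =
     b * z + (\<Sum>i\<in>UNIV. if i \<in> I then w $ i * (x $ i - L_breve w L U $ i * (1 - z))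
                                  else w $ i * U_breve w L U $ i * z)"
  by (simp add: ineq_rhs_expand sum.If_cases Compl_eq)

lemma ineq_rhs_I_hat_le: "ineq_rhs w b L U (I_hat w L U x z) x z \<le> ineq_rhs w b L U I x z"
  unfolding ineq_rhs_eq_sum
  \<comment> \<open>Moving the \<open>L_breve\<close> term to the left, membership in
    \<open>I_hat\<close> says that the term for \<open>i \<in> I\<close> is strictly below the one
    for \<open>i \<notin> I\<close>.\<close>
  by (intro add_left_mono sum_mono) (auto simp: I_hat_def algebra_simps)

theorem proposition13:
  fixes L U w x :: "real^'n" and b y z :: real
  assumes "x \<in> cbox L U" and "y \<ge> 0" and "z \<in> {0..1}"
  shows "if y > b * z
                + (\<Sum>i\<in>I_hat w L U x z. w $ i * (x $ i - L_breve w L U $ i * (1 - z)))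
                + (\<Sum>i\<in>-I_hat w L U x z. w $ i * U_breve w L U $ i * z)
         then most_violated w b L U (I_hat w L U x z) x y z
         else \<forall>I. \<not> violated w b L U I x y z"
  \<comment> \<open>Folding turns the test into violation at \<open>I_hat\<close>. If it fails,
    \<open>y\<close> is at most the smallest right-hand side, hence at most all of them.\<close>
  unfolding ineq_rhs_expand[symmetric] most_violated_def violated_def violation_def
  using ineq_rhs_I_hat_le[of w b L U x z] by (auto intro: order_trans simp: not_less)

end
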